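(* The system $\mathbb{SKYR}$ is sound with respect to the class of all $\mathcal{S}5$-$\mathbf{ELKy^r}$-models: for every set $\Gamma\subseteq\mathcal{L}_{ELKy^r}$ and every $\phi\in\mathcal{L}_{ELKy^r}$, if $\Gamma\vdash_{\mathbb{SKYR}}\phi$ then $\Gamma\models\phi$ (for every model $\mathfrak{M}$ in the class and world $w$, if all formulas of $\Gamma$ hold at $(\mathfrak{M},w)$ then $\phi$ holds at $(\mathfrak{M},w)$).
   Context: Fix a countable set of agents $\mathcal{A}$ and a countably infinite set of atoms $\mathcal{P}$. $\mathcal{L}_{ELKy^r}$: $\phi ::= p\mid\neg\phi\mid(\phi\land\phi)\mid K_a\phi\mid Ky_a^r(\phi,\phi)$; $\to,\top,\bot$ as usual. $\Lambda\subseteq\mathcal{L}_{ELKy^r}$ is a fixed set of formulas valid in the class below (tautology ground). An $\mathcal{S}5$-$\mathbf{ELKy^r}$-model is $\mathfrak{M}=\langle W,E,\{R_a\}_{a\in\mathcal{A}},\mathcal{E},V\rangle$ with $W\neq\emptyset$; $E$ nonempty, containing a designated $e$, closed under a binary operation $\cdot$; each $R_a$ an equivalence relation on $W$; $\mathcal{E}:E\times\mathcal{L}_{ELKy^r}\to 2^W$ with $\mathcal{E}(e,\phi)=W$ for $\phi\in\Lambda$ and $\mathcal{E}(s,\phi\to\psi)\cap\mathcal{E}(t,\phi)\subseteq\mathcal{E}(s\cdot t,\psi)$; $V:\mathcal{P}\to 2^W$. Truth: $p,\neg,\land$ as usual; $K_a\phi$ holds at $w$ iff $\phi$ holds at all $R_a$-successors;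 $Ky_a^r(\phi,\psi)$ holds at $w$ iff there is $t\in E$ such that every $v$ with $(w,v)\in R_a$ and $(\mathfrak{M},v)\models\phi$ satisfies $v\in\mathcal{E}(t,\psi)$ and $(\mathfrak{M},v)\models\psi$. $\mathbb{SKYR}$ has, for all agents and formulas: (PT) propositional tautologies; (K) $K_a(\phi\to\psi)\to(K_a\phi\to K_a\psi)$; (T) $K_a\phi\to\phi$; (4) $K_a\phi\to K_aK_a\phi$; (5) $\neg K_a\phi\to K_a\neg K_a\phi$; (EKyR) $Ky_a^r(\chi,\phi\to\psi)\to(Ky_a^r(\theta,\phi)\to Ky_a^r(\chi\land\theta,\psi))$; (4YKR) $Ky_a^r(\phi,\psi)\to K_aKy_a^r(\phi,\psi)$; (DKyR) $Ky_a^r(\phi,\psi)\to K_a(\phi\to\psi)$; (IKyR) $Ky_a^r(\psi,\chi)\to(K_a(\phi\to\psi)\to Ky_a^r(\phi,\chi))$; (UKyR) $K_a\neg\phi\to Ky_a^r(\phi,\psi)$; rules (MP); (NK) from $\vdash\phi$ infer $\vdash K_a\phi$; (NKyR) from $\phi\in\Lambda$ infer $\vdash Ky_a^r(\top,\phi)$. $\Gamma\vdash\phi$ means $\phi$ follows from $\Gamma$ and theorems of $\mathbb{SKYR}$ by (MP) (the necessitation rules apply only to theorems). *)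

theory Defs
  imports Main "HOL-Library.Countable" "HOL-Library.Infinite_Typeclass"
begin

datatype ('a, 'p) fm =
    Atom 'p
  | Neg "('a, 'p) fm"
  | Con "('a, 'p) fm" "('a, 'p) fm"
  | Kn 'a "('a, 'p) fm"
  | Kyr 'a "('a, 'p) fm" "('a, 'p) fm"

abbreviation Imp :: "('a, 'p) fm \<Rightarrow> ('a, 'p) fm \<Rightarrow> ('a, 'p) fm" where
  "Imp \<phi> \<psi> \<equiv> Neg (Con \<phi> (Neg \<psi>))"

text \<open>The constants are abbreviations in the language: falsum is \<open>p \<and> \<not> p\<close> for one atom \<open>p\<close>,
  arbitrary but fixed.\<close>

definition Bot :: "('a, 'p) fm" where
  "Bot = (let p = (SOME p. True) in Con (Atom p) (Neg (Atom p)))"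

definition Top :: "('a, 'p) fm" where
  "Top = Neg Bot"

record ('w, 'e, 'a, 'p) elkyr_struct =
  Worlds :: "'w set"
  Expl :: "'e set"
  e0 :: 'e
  app :: "'e \<Rightarrow> 'e \<Rightarrow> 'e"
  Acc :: "'a \<Rightarrow> ('w \<times> 'w) set"
  Evid :: "'e \<Rightarrow> ('a, 'p) fm \<Rightarrow> 'w set"
  Val :: "'p \<Rightarrow> 'w set"

definition s5_elkyr_model ::
    "('a, 'p) fm set \<Rightarrow> ('w, 'e, 'a, 'p) elkyr_struct \<Rightarrow> bool" where
  "s5_elkyr_model \<Lambda> M \<longleftrightarrow>
     Worlds M \<noteq> {} \<and>
     e0 M \<in> Expl M \<and>
     (\<forall>s\<in>Expl M. \<forall>t\<in>Expl M. app M s t \<in> Expl M) \<and>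
     (\<forall>a. equiv (Worlds M) (Acc M a)) \<and>
     (\<forall>t\<in>Expl M. \<forall>\<phi>. Evid M t \<phi> \<subseteq> Worlds M) \<and>
     (\<forall>\<phi>\<in>\<Lambda>. Evid M (e0 M) \<phi> = Worlds M) \<and>
     (\<forall>s\<in>Expl M. \<forall>t\<in>Expl M. \<forall>\<phi> \<psi>.
        Evid M s (Imp \<phi> \<psi>) \<inter> Evid M t \<phi> \<subseteq> Evid M (app M s t) \<psi>) \<and>
     (\<forall>p. Val M p \<subseteq> Worlds M)"

primrec sat :: "('w, 'e, 'a, 'p) elkyr_struct \<Rightarrow> 'w \<Rightarrow> ('a, 'p) fm \<Rightarrow> bool" where
  "sat M w (Atom p) \<longleftrightarrow> w \<in> Val M p"
| "sat M w (Neg \<phi>) \<longleftrightarrow> \<not> sat M w \<phi>"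
| "sat M w (Con \<phi> \<psi>) \<longleftrightarrow> sat M w \<phi> \<and> sat M w \<psi>"
| "sat M w (Kn a \<phi>) \<longleftrightarrow> (\<forall>v. (w, v) \<in> Acc M a \<longrightarrow> sat M v \<phi>)"
| "sat M w (Kyr a \<phi> \<psi>) \<longleftrightarrow>
     (\<exists>t\<in>Expl M. \<forall>v. (w, v) \<in> Acc M a \<and> sat M v \<phi> \<longrightarrow> v \<in> Evid M t \<psi> \<and> sat M v \<psi>)"

text \<open>The type arguments range over the types from which the worlds and the explanations of the
  models are drawn; the carriers themselves are arbitrary sets over these types.\<close>

definition entails :: "'w itself \<Rightarrow> 'e itself \<Rightarrow>
    ('a, 'p) fm set \<Rightarrow> ('a, 'p) fm set \<Rightarrow> ('a, 'p) fm \<Rightarrow> bool" where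
  "entails _ _ \<Lambda> \<Gamma> \<phi> \<longleftrightarrow>
     (\<forall>M :: ('w, 'e, 'a, 'p) elkyr_struct. s5_elkyr_model \<Lambda> M \<longrightarrow>
        (\<forall>w\<in>Worlds M. (\<forall>\<gamma>\<in>\<Gamma>. sat M w \<gamma>) \<longrightarrow> sat M w \<phi>))"

definition valid :: "'w itself \<Rightarrow> 'e itself \<Rightarrow> ('a, 'p) fm set \<Rightarrow> ('a, 'p) fm \<Rightarrow> bool" where
  "valid _ _ \<Lambda> \<phi> \<longleftrightarrow>
     (\<forall>M :: ('w, 'e, 'a, 'p) elkyr_struct. s5_elkyr_model \<Lambda> M \<longrightarrow>
        (\<forall>w\<in>Worlds M. sat M w \<phi>))"

text \<open>The class of models itself depends on the ground, so this is a condition relating a set of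
  formulas to the class of models it determines.\<close>

definition tautology_ground :: "'w itself \<Rightarrow> 'e itself \<Rightarrow> ('a, 'p) fm set \<Rightarrow> bool" where
  "tautology_ground tw te \<Lambda> \<longleftrightarrow> (\<forall>\<phi>\<in>\<Lambda>. valid tw te \<Lambda> \<phi>)"

text \<open>Propositional evaluation treats modal formulas as atoms, so that the propositional
  tautologies include all substitution instances in the full language.\<close>

primrec pl_eval :: "(('a, 'p) fm \<Rightarrow> bool) \<Rightarrow> ('a, 'p) fm \<Rightarrow> bool" where
  "pl_eval g (Atom p) = g (Atom p)"
| "pl_eval g (Neg \<phi>) = (\<not> pl_eval g \<phi>)"
| "pl_eval g (Con \<phi> \<psi>) = (pl_eval g \<phi> \<and> pl_eval g \<psi>)"
| "pl_eval g (Kn a \<phi>) = g (Kn a \<phi>)"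
| "pl_eval g (Kyr a \<phi> \<psi>) = g (Kyr a \<phi> \<psi>)"

definition pl_tautology :: "('a, 'p) fm \<Rightarrow> bool" where
  "pl_tautology \<phi> \<longleftrightarrow> (\<forall>g. pl_eval g \<phi>)"

inductive skyr_thm :: "('a, 'p) fm set \<Rightarrow> ('a, 'p) fm \<Rightarrow> bool"
  for \<Lambda> :: "('a, 'p) fm set" where
  PT: "pl_tautology \<phi> \<Longrightarrow> skyr_thm \<Lambda> \<phi>"
| AxK: "skyr_thm \<Lambda> (Imp (Kn a (Imp \<phi> \<psi>)) (Imp (Kn a \<phi>) (Kn a \<psi>)))"
| AxT: "skyr_thm \<Lambda> (Imp (Kn a \<phi>) \<phi>)"
| Ax4: "skyr_thm \<Lambda> (Imp (Kn a \<phi>) (Kn a (Kn a \<phi>)))"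
| Ax5: "skyr_thm \<Lambda> (Imp (Neg (Kn a \<phi>)) (Kn a (Neg (Kn a \<phi>))))"
| EKyR: "skyr_thm \<Lambda> (Imp (Kyr a \<chi> (Imp \<phi> \<psi>)) (Imp (Kyr a \<theta> \<phi>) (Kyr a (Con \<chi> \<theta>) \<psi>)))"
| Ax4YKR: "skyr_thm \<Lambda> (Imp (Kyr a \<phi> \<psi>) (Kn a (Kyr a \<phi> \<psi>)))"
| DKyR: "skyr_thm \<Lambda> (Imp (Kyr a \<phi> \<psi>) (Kn a (Imp \<phi> \<psi>)))"
| IKyR: "skyr_thm \<Lambda> (Imp (Kyr a \<psi> \<chi>) (Imp (Kn a (Imp \<phi> \<psi>)) (Kyr a \<phi> \<chi>)))"
| UKyR: "skyr_thm \<Lambda> (Imp (Kn a (Neg \<phi>)) (Kyr a \<phi> \<psi>))"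
| MP: "skyr_thm \<Lambda> \<phi> \<Longrightarrow> skyr_thm \<Lambda> (Imp \<phi> \<psi>) \<Longrightarrow> skyr_thm \<Lambda> \<psi>"
| NK: "skyr_thm \<Lambda> \<phi> \<Longrightarrow> skyr_thm \<Lambda> (Kn a \<phi>)"
| NKyR: "\<phi> \<in> \<Lambda> \<Longrightarrow> skyr_thm \<Lambda> (Kyr a Top \<phi>)"

inductive skyr_derives :: "('a, 'p) fm set \<Rightarrow> ('a, 'p) fm set \<Rightarrow> ('a, 'p) fm \<Rightarrow> bool"
  for \<Lambda> \<Gamma> :: "('a, 'p) fm set" where
  Premise: "\<phi> \<in> \<Gamma> \<Longrightarrow> skyr_derives \<Lambda> \<Gamma> \<phi>"
| Thm: "skyr_thm \<Lambda> \<phi> \<Longrightarrow> skyr_derives \<Lambda> \<Gamma> \<phi>"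
| MP: "skyr_derives \<Lambda> \<Gamma> \<phi> \<Longrightarrow> skyr_derives \<Lambda> \<Gamma> (Imp \<phi> \<psi>) \<Longrightarrow> skyr_derives \<Lambda> \<Gamma> \<psi>"

end

theory Submission
  imports Defs
begin

text \<open>Soundness of the theorems is by rule induction. Since \<open>R\<^sub>a\<close> is an equivalence, \<open>R\<^sub>a\<close>-related
  worlds have the same \<open>R\<^sub>a\<close>-successors, so they agree on all formulas \<open>K\<^sub>a \<phi>\<close> and \<open>Ky\<^sub>a (\<phi>, \<psi>)\<close>;
  the same explanation witnesses the latter at both. If \<open>s\<close> and \<open>t\<close> witness the antecedents of
  (EKyR), then \<open>s \<cdot> t\<close> witnesses its consequent. The designated explanation witnesses (NKyR), because
  the members of the ground are valid.\<close>

text \<open>Truth at a world is itself a propositional valuation of atoms and modal formulas, so a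
  tautology holds at every world.\<close>

lemma sat_iff_pl_eval: "sat M w \<phi> \<longleftrightarrow> pl_eval (sat M w) \<phi>"
  by (induction \<phi>) auto

context
  fixes \<Lambda> :: "('a, 'p) fm set" and M :: "('w, 'e, 'a, 'p) elkyr_struct"
  assumes model: "s5_elkyr_model \<Lambda> M"
begin

lemma e0_in_Expl: "e0 M \<in> Expl M"
  using model by (simp add: s5_elkyr_model_def)

lemma equiv_Acc: "equiv (Worlds M) (Acc M a)"
  using model by (simp add: s5_elkyr_model_def)

lemma Acc_refl: "w \<in> Worlds M \<Longrightarrow> (w, w) \<in> Acc M a"
  using equiv_Acc[of a] by (meson equivE refl_onD)

lemma Acc_in_Worlds: "(w, v) \<in> Acc M a \<Longrightarrow> v \<in> Worlds M"
  using equiv_type[OF equiv_Acc] by blast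

lemma Acc_successors_eq: "(w, v) \<in> Acc M a \<Longrightarrow> (v, u) \<in> Acc M a \<longleftrightarrow> (w, u) \<in> Acc M a"
  using equiv_Acc[of a] by (meson equivE symD transD)

lemma sat_Kn_Acc: "(w, v) \<in> Acc M a \<Longrightarrow> sat M v (Kn a \<phi>) \<longleftrightarrow> sat M w (Kn a \<phi>)"
  by (simp add: Acc_successors_eq[of w v a])

lemma sat_Kyr_Acc: "(w, v) \<in> Acc M a \<Longrightarrow> sat M v (Kyr a \<phi> \<psi>) \<longleftrightarrow> sat M w (Kyr a \<phi> \<psi>)"
  by (simp add: Acc_successors_eq[of w v a])

lemma sat_EKyR:
  assumes "sat M w (Kyr a \<chi> (Imp \<phi> \<psi>))" and "sat M w (Kyr a \<theta> \<phi>)"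
  shows "sat M w (Kyr a (Con \<chi> \<theta>) \<psi>)"
proof -
  obtain s where s: "s \<in> Expl M"
    "\<And>v. (w, v) \<in> Acc M a \<Longrightarrow> sat M v \<chi> \<Longrightarrow> v \<in> Evid M s (Imp \<phi> \<psi>) \<and> sat M v (Imp \<phi> \<psi>)"
    using assms(1) unfolding sat.simps(5) by blast
  obtain t where t: "t \<in> Expl M"
    "\<And>v. (w, v) \<in> Acc M a \<Longrightarrow> sat M v \<theta> \<Longrightarrow> v \<in> Evid M t \<phi> \<and> sat M v \<phi>"
    using assms(2) unfolding sat.simps(5) by blast
  have "app M s t \<in> Expl M"
    and "Evid M s (Imp \<phi> \<psi>) \<inter> Evid M t \<phi> \<subseteq> Evid M (app M s t) \<psi>"
    using model s(1) t(1) unfolding s5_elkyr_model_def by blast+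
  \<comment> \<open>A successor satisfying both conditions lies in the evidence sets of
    \<open>s\<close> and of \<open>t\<close>, and modus ponens holds there.\<close>
  moreover have "v \<in> Evid M s (Imp \<phi> \<psi>) \<inter> Evid M t \<phi> \<and> sat M v \<psi>"
    if "(w, v) \<in> Acc M a" "sat M v (Con \<chi> \<theta>)" for v
    using s(2)[of v] t(2)[of v] that by auto
  ultimately show ?thesis
    unfolding sat.simps(5) by blast
qed

lemma skyr_thm_sound:
  assumes ground: "tautology_ground TYPE('w) TYPE('e) \<Lambda>"
  shows "skyr_thm \<Lambda> \<phi> \<Longrightarrow> w \<in> Worlds M \<Longrightarrow> sat M w \<phi>"
\<comment> \<open>The world is generalized because \<open>NK\<close> needs the induction hypothesis
  at all successors of \<open>w\<close>.\<close>
proof (induction arbitrary: w rule: skyr_thm.induct)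
  case (PT \<phi>)
  then show ?case
    unfolding pl_tautology_def by (subst sat_iff_pl_eval) blast
next
  case (AxT a \<phi>)
  then show ?case
    by (auto intro: Acc_refl)
next
  case (Ax4 a \<phi>)
  \<comment> \<open>Only the outer \<open>Kn\<close> is unfolded: the inner one must keep the form
    that \<open>sat_Kn_Acc\<close> transfers between related worlds.\<close>
  then show ?case
    using sat_Kn_Acc[of w _ a \<phi>] unfolding sat.simps(2,3) sat.simps(4)[of M w a "Kn a \<phi>"] by blast
next
  case (Ax5 a \<phi>)
  then show ?case
    using sat_Kn_Acc[of w _ a \<phi>] unfolding sat.simps(2,3) sat.simps(4)[of M w a "Neg (Kn a \<phi>)"] by blast
next
  case (EKyR a \<chi> \<phi> \<psi> \<theta>)
  then show ?case
    using sat_EKyR[of w a \<chi> \<phi> \<psi> \<theta>] unfolding sat.simps(2,3) by blast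
next
  case (Ax4YKR a \<phi> \<psi>)
  then show ?case
    using sat_Kyr_Acc[of w _ a \<phi> \<psi>] unfolding sat.simps(2-4) by blast
next
  case (IKyR a \<psi> \<chi> \<phi>)
  then show ?case
    unfolding sat.simps by blast
next
  case (UKyR a \<phi> \<psi>)
  \<comment> \<open>No successor satisfies the condition, so any explanation is a vacuous witness;
    \<open>e0 M\<close> supplies one.\<close>
  then show ?case
    using e0_in_Expl by auto
next
  case (NK \<phi> a)
  then show ?case
    by (auto dest: Acc_in_Worlds)
next
  case (NKyR \<phi> a)
  then have "Evid M (e0 M) \<phi> = Worlds M"
    using model by (simp add: s5_elkyr_model_def)
  moreover have "sat M v \<phi>" if "v \<in> Worlds M" for v
    using ground NKyR.hyps model that by (auto simp: tautology_ground_def valid_def)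
  ultimately show ?case
    using e0_in_Expl by (auto dest: Acc_in_Worlds)
qed (simp_all, blast+)

text \<open>The world stays fixed here: the premises are assumed only at \<open>w\<close>, and
  necessitation is confined to theorems.\<close>

lemma skyr_derives_sound:
  assumes "tautology_ground TYPE('w) TYPE('e) \<Lambda>"
    and "w \<in> Worlds M" and "\<And>\<gamma>. \<gamma> \<in> \<Gamma> \<Longrightarrow> sat M w \<gamma>"
  shows "skyr_derives \<Lambda> \<Gamma> \<phi> \<Longrightarrow> sat M w \<phi>"
  by (induction rule: skyr_derives.induct) (auto simp: assms skyr_thm_sound)

end

theorem theorem3p10:
  fixes \<Lambda> :: "('a::countable, 'p::{countable,infinite}) fm set"
  assumes "tautology_ground TYPE('w) TYPE('e) \<Lambda>"
  shows "\<forall>\<Gamma> \<phi>. skyr_derives \<Lambda> \<Gamma> \<phi> \<longrightarrow> entails TYPE('w) TYPE('e) \<Lambda> \<Gamma> \<phi>"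
  unfolding entails_def by (intro allI impI ballI, rule skyr_derives_sound[OF _ assms]) auto

end
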